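(* Let $A$ be an $n\times m$ matrix with nonnegative integer entries, let $f^A\in\mathcal D^n_m$ be the associated piecewise constant function, and let $(WA,GA)$ be the pair obtained from the classical RSK correspondence (via Greene's theorem). Then $$(WA,GA)=(W_mf^A,G_mf^A)=\operatorname{RSK}_m(f^A).$$
   Context: The entries of $A$ are written $A_{r,i}$, $r\in\{1,\dots,m\}$, $i\in\{1,\dots,n\}$, viewed as weights at the lattice points $(r,i)$ ($r$ is horizontal position, $i$ is the line, line 1 on top). Lattice last passage. For $p=(x,a)$, $q=(y,b)\in\mathbb Z^2$ with $x\le y$, $a\ge b$, a directed path from $p$ to $q$ is a sequence of vertices from $p$ to $q$ with steps in $\{(1,0),(0,-1)\}$. For tuples $(p_1,\dots,p_k)$, $(q_1,\dots,q_k)$ the last passage value $A[\mathbf p\to\mathbf q]$ is the maximum of $\sum_{i=1}^k\sum_{v\in\pi_i}A_v$ over $k$-tuples of pairwise (vertex-)disjoint directed paths $\pi_i$ from $p_i$ to $q_i$. $A[p^{*k}\to q^{*k}]$ denotes the $k$-point last passage value from $(p-(0,k-1),\dots,p-(0,1),p)$ to $(q-(k-1,0),\dots,q-(1,0),q)$. Classical RSK in this language. $WA=(WA_1,\dots,WA_n)$ is the $n$-tuple of functions on $[0,m]$ with $WA_j(t)=0$ for $t<1$ and, for $t\in[1,m]$, $k\in\{1,\dots,n\}$, $\sum_{j=1}^kWA_j(t)=A[(1,n)^{*k\wedge\lfloor t\rfloor}\to(\lfloor t\rfloor,1)^{*k\wedge\lfloor t\rfloor}]$. $GA=\{GA_j(i):1\le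 j\le i\le n\}$ is given by $\sum_{j=1}^kGA_j(i)=A[(1,n)^{*k\wedge m}\to(m,n-i+1)^{*k\wedge m}]$ for $1\le k\le i\le n$. (These encode the recording and insertion tableaux.) Cadlag side. $\mathcal D^n_m$ is the set of $n$-tuples of cadlag functions $f_i:[0,m]\to\mathbb R$ with no negative jumps and $f_i(0)\ge0$, with convention $f_i(0^-)=0$; $df([x,y]\times\{i\})=f_i(y)-f_i(x^-)$. $f^A_i(t)=\sum_{r\in\mathbb Z,\,1\le r\le t}A_{r,i}$. For $p=(x,\ell)$, $q=(y,b)$, $x\le y$, $\ell\ge b$, a path from $p$ to $q$ is a set $\bigcup_{i=b}^{\ell}[t_i,t_{i-1}]\times\{i\}$ with $x=t_\ell\le\dots\le t_{b-1}=y$; paths are essentially disjoint if their intersection is finite; $f[p^k\to q^k]=\sup df(\pi_1\cup\dots\cup\pi_k)$ over $k$-tuples of pairwise essentially disjoint paths from $p$ to $q$, $f[p^0\to q^0]=0$. $W_mf_k(y)=f[(0,n)^k\to(y,1)^k]-f[(0,n)^{k-1}\to(y,1)^{k-1}]$ for $y\in[0,m]$, $k=1,\dots,n$; $G_mf$ is given by $\sum_{i=1}^kG_mf_i(s)=f[(0,n)^k\to(m,n-s+1)^k]$, $1\le k\le s\le n$; $\operatorname{RSK}_m(f)=(W_mf,G_mf)$. *)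

theory Defs
  imports "HOL-Analysis.Analysis"
begin

text \<open>
  Lattice points are pairs \<open>(r, i)\<close> of integers with horizontal position \<open>r\<close> and line \<open>i\<close>, line 1
  being on top; a matrix is a function \<open>A\<close> with \<open>A r i\<close> the entry at \<open>(r, i)\<close>. Only the entries
  with \<open>1 \<le> r \<le> m\<close> and \<open>1 \<le> i \<le> n\<close> matter. All indices are integers, so that no subtraction below
  is truncated. Families indexed by \<open>{1..n}\<close> and functions on \<open>[0, m]\<close> are rendered as functions
  that are \<open>undefined\<close> off their domain, so that equality of families is equality in HOL.
\<close>

section \<open>Lattice last passage\<close>

definition lattice_step :: "int \<times> int \<Rightarrow> int \<times> int \<Rightarrow> bool" where
  "lattice_step u v \<longleftrightarrow> v - u \<in> {(1, 0), (0, -1)}"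

definition lattice_path :: "int \<times> int \<Rightarrow> int \<times> int \<Rightarrow> (int \<times> int) list \<Rightarrow> bool" where
  "lattice_path p q \<pi> \<longleftrightarrow> \<pi> \<noteq> [] \<and> hd \<pi> = p \<and> last \<pi> = q \<and> successively lattice_step \<pi>"

text \<open>
  The last passage value of the \<open>k\<close>-tuples \<open>(p 1, \<dots>, p k)\<close> and \<open>(q 1, \<dots>, q k)\<close>. A directed path
  never repeats a vertex, so summing over its set of vertices loses nothing. There are finitely many
  directed paths between two vertices, so the maximum is over a finite set; for \<open>k = 0\<close> it is \<open>0\<close>.
\<close>

definition lattice_lpp ::
    "(int \<Rightarrow> int \<Rightarrow> real) \<Rightarrow> int \<Rightarrow> (int \<Rightarrow> int \<times> int) \<Rightarrow> (int \<Rightarrow> int \<times> int) \<Rightarrow> real" where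
  "lattice_lpp A k p q =
     Max {\<Sum>i\<in>{1..k}. \<Sum>(r, j)\<in>set (\<pi> i). A r j | \<pi>.
            (\<forall>i\<in>{1..k}. lattice_path (p i) (q i) (\<pi> i)) \<and>
            disjoint_family_on (\<lambda>i. set (\<pi> i)) {1..k}}"

definition lattice_lpp_star ::
    "(int \<Rightarrow> int \<Rightarrow> real) \<Rightarrow> int \<Rightarrow> int \<times> int \<Rightarrow> int \<times> int \<Rightarrow> real" where
  "lattice_lpp_star A k p q = lattice_lpp A k (\<lambda>i. p - (0, k - i)) (\<lambda>i. q - (k - i, 0))"

section \<open>The classical RSK correspondence via Greene's theorem\<close>

text \<open>
  \<open>WA\<close> and \<open>GA\<close> are determined by their partial sums; the definitions take successive differences,
  and the partial sum formulas are \<open>sum_WA\<close> and \<open>sum_GA\<close> below.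
\<close>

definition WA :: "int \<Rightarrow> int \<Rightarrow> (int \<Rightarrow> int \<Rightarrow> real) \<Rightarrow> int \<Rightarrow> real \<Rightarrow> real" where
  "WA m n A = (\<lambda>j\<in>{1..n}. \<lambda>t\<in>{0..real_of_int m}.
     if t < 1 then 0
     else lattice_lpp_star A (min j \<lfloor>t\<rfloor>) (1, n) (\<lfloor>t\<rfloor>, 1)
          - lattice_lpp_star A (min (j - 1) \<lfloor>t\<rfloor>) (1, n) (\<lfloor>t\<rfloor>, 1))"

definition GA :: "int \<Rightarrow> int \<Rightarrow> (int \<Rightarrow> int \<Rightarrow> real) \<Rightarrow> int \<Rightarrow> int \<Rightarrow> real" where
  "GA m n A = (\<lambda>j\<in>{1..n}. \<lambda>i\<in>{j..n}.
     lattice_lpp_star A (min j m) (1, n) (m, n - i + 1)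
     - lattice_lpp_star A (min (j - 1) m) (1, n) (m, n - i + 1))"

section \<open>Cadlag last passage\<close>

definition left_limit :: "(real \<Rightarrow> real) \<Rightarrow> real \<Rightarrow> real" where
  "left_limit g x = (if x \<le> 0 then 0 else Lim (at_left x) g)"

definition cadlag_space :: "int \<Rightarrow> int \<Rightarrow> (int \<Rightarrow> real \<Rightarrow> real) set" where
  "cadlag_space m n = {f. \<forall>i\<in>{1..n}.
     (\<forall>t\<in>{0..<real_of_int m}. continuous (at_right t) (f i)) \<and>
     (\<forall>t\<in>{0<..real_of_int m}. (\<exists>l. (f i \<longlongrightarrow> l) (at_left t)) \<and> left_limit (f i) t \<le> f i t) \<and>
     0 \<le> f i 0}"

text \<open>
  \<open>df f S\<close> is only meant for \<open>S\<close> a finite union of sets \<open>[x, y] \<times> {i}\<close>. The connected components of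
  its slices are then finitely many disjoint closed intervals, so this is the finitely additive
  extension of \<open>df ([x, y] \<times> {i}) = f\<^sub>i(y) - f\<^sub>i(x\<^sup>-)\<close>; points lying in several of the sets
  count once.
\<close>

definition df :: "(int \<Rightarrow> real \<Rightarrow> real) \<Rightarrow> (real \<times> int) set \<Rightarrow> real" where
  "df f S = (\<Sum>i\<in>snd ` S. \<Sum>C\<in>components {x. (x, i) \<in> S}. f i (Sup C) - left_limit (f i) (Inf C))"

definition cadlag_path :: "real \<times> int \<Rightarrow> real \<times> int \<Rightarrow> (real \<times> int) set \<Rightarrow> bool" where
  "cadlag_path p q \<pi> \<longleftrightarrow>
     (\<exists>t :: int \<Rightarrow> real. t (snd p) = fst p \<and> t (snd q - 1) = fst q \<and>
        (\<forall>i\<in>{snd q..snd p}. t i \<le> t (i - 1)) \<and>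
        \<pi> = (\<Union>i\<in>{snd q..snd p}. {t i..t (i - 1)} \<times> {i}))"

definition cadlag_lpp ::
    "(int \<Rightarrow> real \<Rightarrow> real) \<Rightarrow> int \<Rightarrow> real \<times> int \<Rightarrow> real \<times> int \<Rightarrow> real" where
  "cadlag_lpp f k p q =
     (if k = 0 then 0
      else Sup {df f (\<Union>i\<in>{1..k}. \<pi> i) | \<pi>.
             (\<forall>i\<in>{1..k}. cadlag_path p q (\<pi> i)) \<and>
             (\<forall>i\<in>{1..k}. \<forall>j\<in>{1..k}. i \<noteq> j \<longrightarrow> finite (\<pi> i \<inter> \<pi> j))})"

definition Wm :: "int \<Rightarrow> int \<Rightarrow> (int \<Rightarrow> real \<Rightarrow> real) \<Rightarrow> int \<Rightarrow> real \<Rightarrow> real" where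
  "Wm m n f = (\<lambda>k\<in>{1..n}. \<lambda>y\<in>{0..real_of_int m}.
     cadlag_lpp f k (0, n) (y, 1) - cadlag_lpp f (k - 1) (0, n) (y, 1))"

text \<open>As for \<open>GA\<close>, see \<open>sum_Gm\<close> below for the partial sums.\<close>

definition Gm :: "int \<Rightarrow> int \<Rightarrow> (int \<Rightarrow> real \<Rightarrow> real) \<Rightarrow> int \<Rightarrow> int \<Rightarrow> real" where
  "Gm m n f = (\<lambda>k\<in>{1..n}. \<lambda>s\<in>{k..n}.
     cadlag_lpp f k (0, n) (real_of_int m, n - s + 1)
     - cadlag_lpp f (k - 1) (0, n) (real_of_int m, n - s + 1))"

definition RSKm :: "int \<Rightarrow> int \<Rightarrow> (int \<Rightarrow> real \<Rightarrow> real) \<Rightarrow>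
    (int \<Rightarrow> real \<Rightarrow> real) \<times> (int \<Rightarrow> int \<Rightarrow> real)" where
  "RSKm m n f = (Wm m n f, Gm m n f)"

definition matrix_fun :: "(int \<Rightarrow> int \<Rightarrow> real) \<Rightarrow> int \<Rightarrow> real \<Rightarrow> real" where
  "matrix_fun A i t = (\<Sum>r\<in>{r. 1 \<le> r \<and> real_of_int r \<le> t}. A r i)"

section \<open>Checks on the definitions\<close>

lemma lattice_lpp_star_0: "lattice_lpp_star A 0 p q = 0"
proof -
  have "{\<Sum>i\<in>{1..0::int}. \<Sum>(r, j)\<in>set (\<pi> i). A r j | \<pi>.
      (\<forall>i\<in>{1..0}. lattice_path (p - (0, 0 - i)) (q - (0 - i, 0)) (\<pi> i)) \<and>
      disjoint_family_on (\<lambda>i. set (\<pi> i)) {1..0::int}} = {0}"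
    by (auto simp: disjoint_family_on_def)
  then show ?thesis
    unfolding lattice_lpp_star_def lattice_lpp_def by (metis Max_singleton)
qed

lemma sum_telescope_int:
  fixes g :: "int \<Rightarrow> real"
  assumes "0 \<le> k"
  shows "(\<Sum>j\<in>{1..k}. g j - g (j - 1)) = g k - g 0"
  using assms
proof (induction k rule: int_ge_induct)
  case (step k)
  have "{1..k + 1} = insert (k + 1) {1..k}" using step.hyps by auto
  then show ?case using step.IH by simp
qed simp

lemma sum_WA:
  assumes "k \<in> {1..n}" "t \<in> {1..real_of_int m}"
  shows "(\<Sum>j\<in>{1..k}. WA m n A j t) = lattice_lpp_star A (min k \<lfloor>t\<rfloor>) (1, n) (\<lfloor>t\<rfloor>, 1)"
proof -
  have "0 \<le> \<lfloor>t\<rfloor>" using assms by simp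
  have "(\<Sum>j\<in>{1..k}. WA m n A j t) = (\<Sum>j\<in>{1..k}.
      lattice_lpp_star A (min j \<lfloor>t\<rfloor>) (1, n) (\<lfloor>t\<rfloor>, 1)
      - lattice_lpp_star A (min (j - 1) \<lfloor>t\<rfloor>) (1, n) (\<lfloor>t\<rfloor>, 1))"
    using assms by (intro sum.cong) (auto simp: WA_def)
  then show ?thesis
    using sum_telescope_int[of k "\<lambda>j. lattice_lpp_star A (min j \<lfloor>t\<rfloor>) (1, n) (\<lfloor>t\<rfloor>, 1)"]
      assms \<open>0 \<le> \<lfloor>t\<rfloor>\<close> by (simp add: lattice_lpp_star_0)
qed

lemma sum_GA:
  assumes "1 \<le> k" "k \<le> i" "i \<le> n" "0 \<le> m"
  shows "(\<Sum>j\<in>{1..k}. GA m n A j i) = lattice_lpp_star A (min k m) (1, n) (m, n - i + 1)"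
proof -
  have "(\<Sum>j\<in>{1..k}. GA m n A j i) = (\<Sum>j\<in>{1..k}.
      lattice_lpp_star A (min j m) (1, n) (m, n - i + 1)
      - lattice_lpp_star A (min (j - 1) m) (1, n) (m, n - i + 1))"
    using assms by (intro sum.cong) (auto simp: GA_def)
  then show ?thesis
    using sum_telescope_int[of k "\<lambda>j. lattice_lpp_star A (min j m) (1, n) (m, n - i + 1)"]
      assms by (simp add: lattice_lpp_star_0)
qed

lemma sum_Gm:
  assumes "1 \<le> k" "k \<le> s" "s \<le> n"
  shows "(\<Sum>i\<in>{1..k}. Gm m n f i s) = cadlag_lpp f k (0, n) (real_of_int m, n - s + 1)"
proof -
  have "(\<Sum>i\<in>{1..k}. Gm m n f i s) = (\<Sum>i\<in>{1..k}.
      cadlag_lpp f i (0, n) (real_of_int m, n - s + 1)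
      - cadlag_lpp f (i - 1) (0, n) (real_of_int m, n - s + 1))"
    using assms by (intro sum.cong) (auto simp: Gm_def)
  then show ?thesis
    using sum_telescope_int[of k "\<lambda>j. cadlag_lpp f j (0, n) (real_of_int m, n - s + 1)"]
      assms by (simp add: cadlag_lpp_def)
qed

lemma df_interval:
  assumes "x \<le> y"
  shows "df f ({x..y} \<times> {i}) = f i y - left_limit (f i) x"
proof -
  have "components {x..y} = {{x..y}}"
    using assms by (simp add: components_eq_sing_iff)
  moreover have "{x'. (x', i) \<in> {x..y} \<times> {i}} = {x..y}" by auto
  ultimately show ?thesis using assms by (simp add: df_def del: mem_Sigma_iff)
qed

end

theory Submission
  imports Defs
begin

text \<open>
  The increment \<^term>\<open>df (matrix_fun A) U\<close> of the step functions of \<open>A\<close> over a finite union \<open>U\<close> of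
  staircases is the sum of the entries of \<open>A\<close> at the lattice points of \<open>U\<close>, each counted once
  (\<open>df_matrix_fun_staircases\<close>). So both last passage values maximise the weight of a set of lattice
  points, and it remains to compare the sets available on the two sides.

  Order the lattice by \<open>(r, i) \<preceq> (r', i')\<close> if \<open>r \<le> r'\<close> and \<open>i \<ge> i'\<close>. The points on a single path of
  either kind form a chain, so a tuple of \<open>k\<close> paths meets the lattice in a union of \<open>k\<close> chains. The
  heart of the proof is the converse \<open>union_of_chains_covered_by_star_tuple\<close>: if \<open>k\<close> exceeds neither
  side of a rectangle, then every union of \<open>k\<close> chains in it is covered by \<open>k\<close> disjoint lattice paths
  with the prescribed endpoints in the two corners. Since the weights are nonnegative, covering is
  all that is needed.

  The covering paths come from a Greene--Dilworth layering. Two points are incomparable exactly if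
  one lies strictly south-east of the other. Given a set \<open>T\<close>, the \<open>l\<close>-th shadow of \<open>T\<close> consists of
  the points weakly south-east of the last point of a strictly south-east going sequence of length
  \<open>l\<close> in \<open>T\<close>. The north-west rim of each shadow that is neither empty nor everything is a bi-infinite
  lattice path, rims of different shadows are disjoint, and every point of \<open>T\<close> that is in only
  finitely many shadows lies on the rim of the last one, its level. A union \<open>S\<close> of \<open>k\<close> chains
  has at most \<open>k\<close> levels. Adding to \<open>S\<close> suitable rays that enter the rectangle at its two corners
  keeps the levels of the points of \<open>S\<close> at most \<open>k\<close> and steers the \<open>l\<close>-th rim through the \<open>l\<close>-th starting
  point and the \<open>l\<close>-th endpoint.

  From cadlag to lattice paths the covering lemma is applied to the columns \<open>1..x\<close> with
  \<open>x = \<lfloor>y\<rfloor>\<close>; if \<open>k > x\<close>, the \<open>x\<close> columns themselves are a decomposition into chains, which explains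
  the minimum of \<open>k\<close> and \<open>x\<close>. From lattice to cadlag paths it is applied to the wider range of columns
  \<open>1 - k..x + k\<close>, and the horizontal coordinates of the resulting paths are then clamped to
  \<open>[0, y]\<close>: the disjoint lattice paths become essentially disjoint cadlag paths which all start at
  \<open>(0, n)\<close> and end at \<open>(y, b)\<close>.
\<close>

section \<open>Staircases\<close>

text \<open>
  The common shape of both kinds of paths: with real coordinates it is a cadlag path, and with
  integer coordinates the vertex set of a lattice path. On line \<open>i\<close> the path runs from column \<open>t i\<close>
  to column \<open>t (i - 1)\<close>.
\<close>

definition staircase :: "(int \<Rightarrow> 'a::linorder) \<Rightarrow> int \<Rightarrow> int \<Rightarrow> ('a \<times> int) set" where
  "staircase t b e = (\<Union>i\<in>{b..e}. {t i..t (i - 1)} \<times> {i})"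

lemma mem_staircase: "(r, i) \<in> staircase t b e \<longleftrightarrow> b \<le> i \<and> i \<le> e \<and> t i \<le> r \<and> r \<le> t (i - 1)"
  by (auto simp: staircase_def)

lemma staircase_bounds_antimono:
  fixes t :: "int \<Rightarrow> 'a::linorder"
  assumes "\<forall>i\<in>{b..e}. t i \<le> t (i - 1)" "b - 1 \<le> i" "i \<le> j" "j \<le> e"
  shows "t j \<le> t i"
  using assms(3,4)
proof (induction j rule: int_ge_induct)
  case (step j)
  have "t (j + 1) \<le> t j"
    using assms(1,2) step.hyps step.prems by (auto dest: bspec[where x = "j + 1"])
  then show ?case using step by auto
qed simp

text \<open>
  The points of a staircase form a chain: a lower line is left, for good, at the column where the
  next line above is entered.
\<close>

lemma staircase_weakly_monotone:
  fixes t :: "int \<Rightarrow> 'a::linorder"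
  assumes "\<forall>i\<in>{b..e}. t i \<le> t (i - 1)"
    and "(r, i) \<in> staircase t b e" "(r', i') \<in> staircase t b e" "i < i'"
  shows "r' \<le> r"
proof -
  have "t (i' - 1) \<le> t i"
    using assms by (intro staircase_bounds_antimono[OF assms(1)]) (auto simp: mem_staircase)
  then show ?thesis using assms by (auto simp: mem_staircase)
qed

lemma staircase_columns:
  fixes t :: "int \<Rightarrow> 'a::linorder"
  assumes "\<forall>i\<in>{b..e}. t i \<le> t (i - 1)" "(r, i) \<in> staircase t b e"
  shows "t e \<le> r" "r \<le> t (b - 1)"
proof -
  have i: "b \<le> i" "i \<le> e" "t i \<le> r" "r \<le> t (i - 1)" using assms(2) by (auto simp: mem_staircase)
  have "t e \<le> t i" "t (i - 1) \<le> t (b - 1)"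
    using i by (auto intro!: staircase_bounds_antimono[OF assms(1)])
  then show "t e \<le> r" "r \<le> t (b - 1)" using i by auto
qed

text \<open>
  Induction along the path: prepending a vertex \<open>(r, i)\<close> only moves the column at which line \<open>i\<close> is
  entered to \<open>r\<close>, whether the first step is horizontal or vertical.
\<close>

lemma lattice_path_staircase:
  assumes "lattice_path p q \<pi>"
  obtains t :: "int \<Rightarrow> int" where "t (snd p) = fst p" "t (snd q - 1) = fst q" "snd q \<le> snd p"
    "\<forall>i\<in>{snd q..snd p}. t i \<le> t (i - 1)" "set \<pi> = staircase t (snd q) (snd p)"
proof -
  have "\<exists>t :: int \<Rightarrow> int. t (snd p) = fst p \<and> t (snd q - 1) = fst q \<and> snd q \<le> snd p \<and>
    (\<forall>i\<in>{snd q..snd p}. t i \<le> t (i - 1)) \<and> set \<pi> = staircase t (snd q) (snd p)"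
    using assms
  proof (induction \<pi> arbitrary: p)
    case Nil
    then show ?case by (simp add: lattice_path_def)
  next
    case (Cons u \<pi>)
    show ?case
    proof (cases "\<pi> = []")
      case True
      with Cons.prems have "p = u" "q = u" by (auto simp: lattice_path_def)
      with True show ?thesis
        by (intro exI[of _ "\<lambda>_. fst u"]) (auto simp: staircase_def)
    next
      case False
      let ?v = "hd \<pi>"
      from False Cons.prems have u: "p = u" and v: "lattice_path ?v q \<pi>" "lattice_step u ?v"
        by (auto simp: lattice_path_def successively_Cons)
      from Cons.IH[OF v(1)] obtain t where t: "t (snd ?v) = fst ?v" "t (snd q - 1) = fst q"
        "snd q \<le> snd ?v" "\<forall>i\<in>{snd q..snd ?v}. t i \<le> t (i - 1)"
        "set \<pi> = staircase t (snd q) (snd ?v)"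
        by blast
      obtain r i where ri: "u = (r, i)" by (cases u)
      have step: "?v = (r + 1, i) \<or> ?v = (r, i - 1)"
        using v(2) ri by (cases ?v) (auto simp: lattice_step_def)
      let ?t = "t(i := r)"
      have vertices: "set (u # \<pi>) = staircase ?t (snd q) i"
      proof -
        have "w \<in> set (u # \<pi>) \<longleftrightarrow> w \<in> staircase ?t (snd q) i" for w
          using step
        proof
          assume h: "?v = (r + 1, i)"
          have "r + 1 \<le> t (i - 1)" 
          using t(1,3) h bspec[OF t(4), of i] by simp
          then show ?thesis using t h ri
            by (cases w) (auto simp: mem_staircase)
        next
          assume h: "?v = (r, i - 1)"
          have "t (i - 1) = r" using t h by auto
          then show ?thesis using t h ri
            by (cases w) (auto simp: mem_staircase)
        qed
        then show ?thesis by blast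
      qed
      have "r \<le> t (i - 1)"
        using step
      proof
        assume h: "?v = (r + 1, i)"
        then have "t i \<le> t (i - 1)" using t(3) by (intro bspec[OF t(4)]) simp
        then show ?thesis using t(1) h by simp
      next
        assume "?v = (r, i - 1)"
        then show ?thesis using t(1) by simp
      qed
      then have mono: "\<forall>l\<in>{snd q..i}. ?t l \<le> ?t (l - 1)"
        using step t by auto
      have p: "p = (r, i)" and "snd q \<le> i" using step t(3) u ri by auto
      then have "?t (snd p) = fst p" "?t (snd q - 1) = fst q" "snd q \<le> snd p"
        using t(2) by auto
      with vertices mono show ?thesis unfolding p by (intro exI[of _ ?t]) (simp only: snd_conv)
    qed
  qed
  then show ?thesis using that by blast
qed

section \<open>Unions of chains\<close>

text \<open>
  A decomposition into chains is encoded as a colouring \<open>c\<close> with colours \<open>1..k\<close>, in which two points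
  of the same colour are never strictly south-east of each other.
\<close>

definition union_of_chains :: "int \<Rightarrow> (int \<times> int) set \<Rightarrow> bool" where
  "union_of_chains k S \<longleftrightarrow> (\<exists>c. c ` S \<subseteq> {1..k} \<and>
     (\<forall>u\<in>S. \<forall>v\<in>S. c u = c v \<longrightarrow> \<not> (fst u < fst v \<and> snd u < snd v)))"

text \<open>
  \<open>shadow T l\<close> is the set of points that lie weakly south-east of the last term of a sequence
  \<open>u\<^sub>1, \<dots>, u\<^sub>l\<close> in \<open>T\<close>, each term strictly south-east of the previous one. In the recursive form
  \<open>u\<close> is the last term; the term before it is weakly north-west of \<open>u - (1, 1)\<close>.
\<close>

primrec shadow :: "(int \<times> int) set \<Rightarrow> nat \<Rightarrow> (int \<times> int) set" where
  "shadow T 0 = UNIV"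
| "shadow T (Suc l) =
     {v. \<exists>u\<in>T. fst u \<le> fst v \<and> snd u \<le> snd v \<and> u - (1, 1) \<in> shadow T l}"

lemma union_of_chainsI:
  assumes "S \<subseteq> (\<Union>j\<in>{1..k}. P j)"
    and "\<And>j u v. j \<in> {1..k} \<Longrightarrow> u \<in> S \<inter> P j \<Longrightarrow> v \<in> S \<inter> P j \<Longrightarrow> snd u < snd v \<Longrightarrow>
      fst v \<le> fst u"
  shows "union_of_chains k S"
proof -
  from assms(1) have "\<forall>v\<in>S. \<exists>j. j \<in> {1..k} \<and> v \<in> P j" by blast
  from bchoice[OF this] obtain c where c: "\<forall>v\<in>S. c v \<in> {1..k} \<and> v \<in> P (c v)" ..
  then have "\<not> (fst u < fst v \<and> snd u < snd v)" if "u \<in> S" "v \<in> S" "c u = c v" for u v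
    using assms(2)[of "c u" u v] that by fastforce
  then show ?thesis unfolding union_of_chains_def using c by (intro exI[of _ c]) auto
qed

lemma union_of_chains_mono:
  assumes "union_of_chains k S" "k \<le> l"
  shows "union_of_chains l S"
proof -
  have "{1..k} \<subseteq> {1..l}" using assms(2) by simp
  then show ?thesis
    using assms(1) unfolding union_of_chains_def by (meson subset_trans)
qed

lemma union_of_chains_columns:
  assumes "S \<subseteq> {1..x} \<times> B"
  shows "union_of_chains x S"
  unfolding union_of_chains_def using assms by (intro exI[of _ fst]) auto

text \<open>
  Lines are numbered from the top, so increasing both coordinates means moving to the south-east;
  upward sets are closed under such moves.
\<close>

definition upward :: "(int \<times> int) set \<Rightarrow> bool" where
  "upward D \<longleftrightarrow> (\<forall>u\<in>D. \<forall>v. fst u \<le> fst v \<longrightarrow> snd u \<le> snd v \<longrightarrow> v \<in> D)"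

lemma upwardD: "upward D \<Longrightarrow> u \<in> D \<Longrightarrow> fst u \<le> fst v \<Longrightarrow> snd u \<le> snd v \<Longrightarrow> v \<in> D"
  unfolding upward_def by blast

lemma upward_shadow: "upward (shadow T l)"
  unfolding upward_def by (cases l) (auto intro: order_trans)

lemma shadow_SucD: "v \<in> shadow T (Suc l) \<Longrightarrow> v - (1, 1) \<in> shadow T l"
  by (auto elim: upwardD[OF upward_shadow])

lemma shadow_SucI: "v \<in> T \<Longrightarrow> v - (1, 1) \<in> shadow T l \<Longrightarrow> v \<in> shadow T (Suc l)"
  by auto

lemma shadow_antimono: "l \<le> l' \<Longrightarrow> shadow T l' \<subseteq> shadow T l"
proof (induction rule: dec_induct)
  case (step l')
  have "shadow T (Suc l') \<subseteq> shadow T l'"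
  proof
    fix v assume "v \<in> shadow T (Suc l')"
    from upwardD[OF upward_shadow shadow_SucD[OF this]] show "v \<in> shadow T l'" by simp
  qed
  then show ?case using step.IH by blast
qed simp

text \<open>
  If no point of \<open>T\<close> lies weakly north-west of \<open>(a, c)\<close>, then the first term of a south-east going
  sequence exceeds \<open>(a, c)\<close> in one of the coordinates. That coordinate grows by at least one with each
  of the following terms.
\<close>

lemma shadow_subset_corner:
  assumes "\<And>u. u \<in> T \<Longrightarrow> a < fst u \<or> c < snd u" and "v \<in> shadow T l" "0 < l"
  shows "a + int l \<le> fst v \<or> c + int l \<le> snd v"
proof -
  obtain l' where "l = Suc l'" using assms(3) by (cases l) auto
  moreover have "v \<in> shadow T (Suc l') \<Longrightarrow>
      a + int (Suc l') \<le> fst v \<or> c + int (Suc l') \<le> snd v" for v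
  proof (induction l' arbitrary: v)
    case 0
    then show ?case using assms(1) by fastforce
  next
    case (Suc l')
    then obtain u where u: "fst u \<le> fst v" "snd u \<le> snd v" "u - (1, 1) \<in> shadow T (Suc l')"
      by auto
    from Suc.IH[OF u(3)] show ?case using u(1,2) by auto
  qed
  ultimately show ?thesis using assms(2) by blast
qed

text \<open>
  Pigeonhole: the terms of a strictly south-east going sequence have pairwise different colours, so
  there are at most \<open>k\<close> of them.
\<close>

lemma union_of_chains_shadow_empty:
  assumes "union_of_chains k S" "0 \<le> k"
  shows "shadow S (Suc (nat k)) = {}"
proof -
  obtain c where c: "c ` S \<subseteq> {1..k}"
    "\<And>u v. u \<in> S \<Longrightarrow> v \<in> S \<Longrightarrow> fst u < fst v \<Longrightarrow> snd u < snd v \<Longrightarrow> c u \<noteq> c v"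
    using assms(1) unfolding union_of_chains_def by blast
  have chain: "\<exists>C\<subseteq>S. finite C \<and> card C = l \<and> inj_on c C \<and>
      (\<forall>u\<in>C. fst u \<le> fst v \<and> snd u \<le> snd v)" if "v \<in> shadow S l" for v l
    using that
  proof (induction l arbitrary: v)
    case 0
    then show ?case by (intro exI[of _ "{}"]) auto
  next
    case (Suc l)
    then obtain u where u: "u \<in> S" "fst u \<le> fst v" "snd u \<le> snd v" "u - (1, 1) \<in> shadow S l"
      by auto
    from Suc.IH[OF u(4)] obtain C where C: "C \<subseteq> S" "finite C" "card C = l" "inj_on c C"
      "\<forall>w\<in>C. fst w \<le> fst u - 1 \<and> snd w \<le> snd u - 1"
      by auto
    have "u \<notin> C" using C(5) by force
    moreover have "c w \<noteq> c u" if "w \<in> C" for w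
      using c(2)[of w u] C(1,5) u(1) that by force
    ultimately show ?case
      using C u by (intro exI[of _ "insert u C"]) force
  qed
  have False if v: "v \<in> shadow S (Suc (nat k))" for v
  proof -
    obtain C where C: "C \<subseteq> S" "card C = Suc (nat k)" "inj_on c C"
      using chain[OF v] by blast
    have "card (c ` C) \<le> card {1..k}"
      using C(1) c(1) by (intro card_mono) auto
    then show False using C(2,3) by (simp add: card_image)
  qed
  then show ?thesis by blast
qed

section \<open>Rims are lattice paths\<close>

text \<open>
  The north-west boundary of an upward set \<open>D\<close>.
\<close>

definition rim :: "(int \<times> int) set \<Rightarrow> (int \<times> int) set" where
  "rim D = {v \<in> D. v - (1, 1) \<notin> D}"

lemma rim_unique_on_diagonal:
  assumes "upward D"
    and "u \<in> rim D" "v \<in> rim D" "fst u - snd u = fst v - snd v"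
  shows "u = v"
proof -
  have "\<not> fst u < fst v" if "u \<in> rim D" "v \<in> rim D" "fst u - snd u = fst v - snd v" for u v
    using upwardD[OF assms(1), of u "v - (1, 1)"] that by (auto simp: rim_def)
  from this[of u v] this[of v u] show ?thesis
    using assms by (auto simp: prod_eq_iff)
qed

text \<open>
  Each diagonal, on which \<open>r - i\<close> is constant, contains at most one rim point, and a step of a lattice
  path moves on to the next diagonal. From a rim point \<open>p\<close> the path goes up if this stays in \<open>D\<close>, and
  to the right otherwise; either way it arrives at the rim point of the next diagonal. Hence the path
  from \<open>p\<close> to \<open>q\<close> collects all rim points on the diagonals in between.
\<close>

lemma rim_is_lattice_path:
  assumes up: "upward D"
    and "p \<in> rim D" "q \<in> rim D" "fst p - snd p \<le> fst q - snd q"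
  shows "\<exists>\<pi>. lattice_path p q \<pi> \<and>
    set \<pi> = {v \<in> rim D. fst p - snd p \<le> fst v - snd v \<and> fst v - snd v \<le> fst q - snd q}"
  using assms(2,4)
proof (induction "nat ((fst q - snd q) - (fst p - snd p))" arbitrary: p)
  case 0
  then have "fst p - snd p = fst q - snd q" by simp
  moreover from this have "p = q"
    using rim_unique_on_diagonal[OF up 0(2) assms(3)] by simp
  moreover have "{v \<in> rim D. fst q - snd q \<le> fst v - snd v \<and> fst v - snd v \<le> fst q - snd q} = {q}"
    using rim_unique_on_diagonal[OF up _ assms(3)] assms(3) by force
  ultimately show ?case by (intro exI[of _ "[q]"]) (simp add: lattice_path_def)
next
  case (Suc d)
  define p' where "p' = (if p - (0, 1) \<in> D then p - (0, 1) else p + (1, 0))"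
  have p: "p \<in> D" "p - (1, 1) \<notin> D" using Suc.prems(1) by (auto simp: rim_def)
  have "p + (1, 0) \<in> D" by (rule upwardD[OF up p(1)]) auto
  moreover have "p - (0, 1) - (1, 1) \<notin> D"
  proof
    assume "p - (0, 1) - (1, 1) \<in> D"
    then have "p - (1, 1) \<in> D" by (rule upwardD[OF up]) auto
    then show False using p(2) by simp
  qed
  moreover have "p + (1, 0) - (1, 1) = p - (0, 1)" by (simp add: prod_eq_iff)
  ultimately have p': "p' \<in> rim D"
    unfolding p'_def rim_def by (metis (no_types, lifting) mem_Collect_eq)
  have d': "fst p' - snd p' = fst p - snd p + 1" by (auto simp: p'_def)
  have "d = nat ((fst q - snd q) - (fst p' - snd p'))" "fst p' - snd p' \<le> fst q - snd q"
    using Suc.hyps(2) d' by auto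
  from Suc.hyps(1)[OF this(1) p' this(2)] obtain \<pi> where \<pi>: "lattice_path p' q \<pi>"
    "set \<pi> = {v \<in> rim D. fst p' - snd p' \<le> fst v - snd v \<and> fst v - snd v \<le> fst q - snd q}"
    by blast
  have "lattice_step p p'" by (auto simp: lattice_step_def p'_def prod_eq_iff)
  then have "lattice_path p q (p # \<pi>)"
    using \<pi>(1) by (auto simp: lattice_path_def successively_Cons)
  moreover have "set (p # \<pi>) =
      {v \<in> rim D. fst p - snd p \<le> fst v - snd v \<and> fst v - snd v \<le> fst q - snd q}"
  proof -
    have "v = p" if "v \<in> rim D" "fst p - snd p \<le> fst v - snd v"
      "\<not> fst p' - snd p' \<le> fst v - snd v" for v
      using rim_unique_on_diagonal[OF up that(1) Suc.prems(1)] that d' by simp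
    then show ?thesis using \<pi>(2) Suc.prems d' by auto
  qed
  ultimately show ?case by blast
qed

text \<open>
  A point of the \<open>l'\<close>-th shadow with \<open>l < l'\<close> has its north-west diagonal neighbour in the \<open>l\<close>-th
  shadow, so it is not on the rim of the latter.
\<close>

lemma disjoint_rims_shadow:
  assumes "l \<noteq> l'"
  shows "rim (shadow T l) \<inter> rim (shadow T l') = {}"
proof -
  have "rim (shadow T l) \<inter> rim (shadow T l') = {}" if "l < l'" for l l'
  proof -
    have "v - (1, 1) \<in> shadow T l" if "v \<in> shadow T l'" for v
    proof -
      have "v \<in> shadow T (Suc l)" using that shadow_antimono[of "Suc l" l' T] \<open>l < l'\<close> by auto
      then show ?thesis by (rule shadow_SucD)
    qed
    then show ?thesis by (auto simp: rim_def)
  qed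
  from this[of l l'] this[of l' l] assms show ?thesis by (cases "l < l'") auto
qed

text \<open>
  The tuples of paths that are admitted in \<^term>\<open>lattice_lpp_star A k p q\<close>.
\<close>

definition star_tuple ::
    "int \<Rightarrow> int \<times> int \<Rightarrow> int \<times> int \<Rightarrow> (int \<Rightarrow> (int \<times> int) list) \<Rightarrow> bool" where
  "star_tuple k p q \<pi> \<longleftrightarrow>
     (\<forall>j\<in>{1..k}. lattice_path (p - (0, k - j)) (q - (k - j, 0)) (\<pi> j)) \<and>
     disjoint_family_on (\<lambda>j. set (\<pi> j)) {1..k}"

lemma star_tuple_iff:
  "star_tuple k (x0, n) (x1, b) \<pi> \<longleftrightarrow>
     (\<forall>j\<in>{1..k}. lattice_path (x0, n - k + j) (x1 - k + j, b) (\<pi> j)) \<and>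
     disjoint_family_on (\<lambda>j. set (\<pi> j)) {1..k}"
  by (simp add: star_tuple_def algebra_simps)

text \<open>
  The paths are the rims of the first \<open>k\<close> shadows of \<open>S\<close> enlarged by horizontal rays \<open>L\<close> and vertical
  rays \<open>R\<close>. The \<open>l\<close>-th ray of \<open>L\<close> runs on line \<open>n - k + l\<close> to the left of column \<open>x0 + l\<close>, so that it
  passes through the \<open>l\<close>-th starting point; its end lies on the diagonal that cuts off the south-west
  corner of the rectangle. The \<open>l\<close>-th ray of \<open>R\<close> runs in column \<open>x1 - k + l\<close> above line \<open>b + l\<close>. The
  points of the \<open>l\<close>-th rays have level exactly \<open>l\<close>, by counting lines for \<open>L\<close> and columns for \<open>R\<close>.
\<close>

lemma union_of_chains_covered_by_star_tuple:
  fixes x0 x1 b n k :: int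
  assumes k: "1 \<le> k" "k \<le> x1 - x0 + 1" "k \<le> n - b + 1"
    and S: "S \<subseteq> {x0..x1} \<times> {b..n}" "union_of_chains k S"
  obtains \<pi> where "star_tuple k (x0, n) (x1, b) \<pi>" "S \<subseteq> (\<Union>j\<in>{1..k}. set (\<pi> j))"
proof -
  define L where "L = {(r, i). n - k < i \<and> i \<le> n \<and> r - i \<le> x0 - 1 - (n - k)}"
  define R where "R = {(r, i). x1 - k < r \<and> r \<le> x1 \<and> i - r \<le> b - 1 - (x1 - k)}"
  define T where "T = S \<union> L \<union> R"
  have corner_sw: "x0 - 1 + int l \<le> fst v \<or> n - k + int l \<le> snd v"
    if "v \<in> shadow T l" "0 < l" for v l
    using S(1) k that
    by (intro shadow_subset_corner[of T]) (force simp: T_def L_def R_def)+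
  have corner_ne: "x1 - k + int l \<le> fst v \<or> b - 1 + int l \<le> snd v"
    if "v \<in> shadow T l" "0 < l" for v l
    using S(1) k that
    by (intro shadow_subset_corner[of T]) (force simp: T_def L_def R_def)+
  have L_level: "(r, n - k + int l) \<in> shadow T l" if "int l \<le> k" "r \<le> x0 - 1 + int l" for r l
    using that
  proof (induction l arbitrary: r)
    case (Suc l)
    then show ?case
      by (intro shadow_SucI) (auto simp: T_def L_def algebra_simps)
  qed simp
  have R_level: "(x1 - k + int l, i) \<in> shadow T l" if "int l \<le> k" "i \<le> b - 1 + int l" for i l
    using that
  proof (induction l arbitrary: i)
    case (Suc l)
    then show ?case
      by (intro shadow_SucI) (auto simp: T_def R_def algebra_simps)
  qed simp
  \<comment> \<open>A sequence in \<open>T\<close> either stays in \<open>S\<close>, or it uses a ray. A term on the \<open>j\<close>-th ray of \<open>L\<close>, which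
    is on line \<open>n - k + j\<close>, is at most the \<open>j\<close>-th one, so from there on the \<open>l\<close>-th term is on line
    \<open>n - k + l\<close> or below it; likewise for \<open>R\<close> and the columns.\<close>
  have shadow_S_or_late: "v \<in> shadow S l \<or> n - k + int l \<le> snd v \<or> x1 - k + int l \<le> fst v"
    if "v \<in> shadow T l" for v l
    using that
  proof (induction l arbitrary: v)
    case (Suc l)
    then obtain u where u: "u \<in> T" "fst u \<le> fst v" "snd u \<le> snd v" "u - (1, 1) \<in> shadow T l"
      by auto
    have "u \<in> shadow T (Suc l)" using u(1,4) by (rule shadow_SucI)
    from corner_sw[OF this] corner_ne[OF this]
    have c: "x0 + int l \<le> fst u \<or> n - k + int l + 1 \<le> snd u"
      "x1 - k + int l + 1 \<le> fst u \<or> b + int l \<le> snd u"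
      by auto
    show ?case
    proof (cases "u \<in> S")
      case True
      then show ?thesis using Suc.IH[OF u(4)] u(2,3) by auto
    next
      case False
      then have "u \<in> L \<or> u \<in> R" using u(1) by (auto simp: T_def)
      then show ?thesis using c u(2,3) by (auto simp: L_def R_def)
    qed
  qed simp
  \<comment> \<open>Points of \<open>S\<close> have level at most \<open>k\<close>: at level \<open>k + 1\<close> a sequence within \<open>S\<close> is too long, and a
    sequence using a ray has left the rectangle.\<close>
  have top: "v - (1, 1) \<notin> shadow T (nat k)" if "v \<in> S" for v
  proof
    assume "v - (1, 1) \<in> shadow T (nat k)"
    then have "v \<in> shadow T (Suc (nat k))" using that by (intro shadow_SucI) (auto simp: T_def)
    from shadow_S_or_late[OF this] union_of_chains_shadow_empty[OF S(2)] k(1)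
    have "n < snd v \<or> x1 < fst v" by auto
    then show False using that S(1) by auto
  qed
  have p_rim: "(x0, n - k + j) \<in> rim (shadow T (nat j))" if "j \<in> {1..k}" for j
  proof -
    have "(x0, n - k + j) \<in> shadow T (nat j)" using L_level[of "nat j" x0] that by simp
    moreover have "(x0, n - k + j) - (1, 1) \<notin> shadow T (nat j)"
      using corner_sw[of "(x0, n - k + j) - (1, 1)" "nat j"] that by auto
    ultimately show ?thesis by (simp add: rim_def)
  qed
  have q_rim: "(x1 - k + j, b) \<in> rim (shadow T (nat j))" if "j \<in> {1..k}" for j
  proof -
    have "(x1 - k + j, b) \<in> shadow T (nat j)" using R_level[of "nat j" b] that by simp
    moreover have "(x1 - k + j, b) - (1, 1) \<notin> shadow T (nat j)"
      using corner_ne[of "(x1 - k + j, b) - (1, 1)" "nat j"] that by auto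
    ultimately show ?thesis by (simp add: rim_def)
  qed
  have "\<exists>\<pi>. lattice_path (x0, n - k + j) (x1 - k + j, b) \<pi> \<and>
      set \<pi> = {v \<in> rim (shadow T (nat j)).
        x0 - (n - k + j) \<le> fst v - snd v \<and> fst v - snd v \<le> x1 - k + j - b}"
    if "j \<in> {1..k}" for j
    using rim_is_lattice_path[OF upward_shadow p_rim[OF that] q_rim[OF that]] that k by simp
  then have "\<forall>j\<in>{1..k}. \<exists>\<pi>. lattice_path (x0, n - k + j) (x1 - k + j, b) \<pi> \<and>
      set \<pi> = {v \<in> rim (shadow T (nat j)).
        x0 - (n - k + j) \<le> fst v - snd v \<and> fst v - snd v \<le> x1 - k + j - b}"
    by blast
  from bchoice[OF this] obtain \<pi> where
    "\<forall>j\<in>{1..k}. lattice_path (x0, n - k + j) (x1 - k + j, b) (\<pi> j) \<and>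
      set (\<pi> j) = {v \<in> rim (shadow T (nat j)).
        x0 - (n - k + j) \<le> fst v - snd v \<and> fst v - snd v \<le> x1 - k + j - b}" ..
  then have \<pi>: "\<And>j. j \<in> {1..k} \<Longrightarrow> lattice_path (x0, n - k + j) (x1 - k + j, b) (\<pi> j)"
    "\<And>j. j \<in> {1..k} \<Longrightarrow> set (\<pi> j) = {v \<in> rim (shadow T (nat j)).
        x0 - (n - k + j) \<le> fst v - snd v \<and> fst v - snd v \<le> x1 - k + j - b}"
    by blast+
  have "set (\<pi> i) \<inter> set (\<pi> j) = {}" if "i \<in> {1..k}" "j \<in> {1..k}" "i \<noteq> j" for i j
  proof -
    have "nat i \<noteq> nat j" using that by auto
    from disjoint_rims_shadow[OF this, of T] show ?thesis using \<pi>(2) that(1,2) by auto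
  qed
  then have disj: "disjoint_family_on (\<lambda>j. set (\<pi> j)) {1..k}"
    by (auto simp: disjoint_family_on_def)
  have "v \<in> (\<Union>j\<in>{1..k}. set (\<pi> j))" if v: "v \<in> S" for v
  proof -
    obtain r i where ri: "v = (r, i)" by (cases v)
    have rect: "x0 \<le> r" "r \<le> x1" "b \<le> i" "i \<le> n" using v ri S(1) by auto
    \<comment> \<open>The level of \<open>v\<close>; it is positive, since the shadow number \<open>0\<close> is everything.\<close>
    define l where "l = (LEAST l. v - (1, 1) \<notin> shadow T l)"
    have l: "v - (1, 1) \<notin> shadow T l" "l \<le> nat k"
      using LeastI[of "\<lambda>l. v - (1, 1) \<notin> shadow T l", OF top[OF v]]
        Least_le[of "\<lambda>l. v - (1, 1) \<notin> shadow T l", OF top[OF v]]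
      unfolding l_def by auto
    then obtain l' where l': "l = Suc l'" by (cases l) auto
    have "v - (1, 1) \<in> shadow T l'"
      using not_less_Least[of l' "\<lambda>l. v - (1, 1) \<notin> shadow T l"] l' unfolding l_def by simp
    then have "v \<in> shadow T l" using v unfolding l' by (intro shadow_SucI) (auto simp: T_def)
    with l(1) have vrim: "v \<in> rim (shadow T l)" by (simp add: rim_def)
    \<comment> \<open>On a diagonal before that of the \<open>l\<close>-th starting point, \<open>v - (1, 1)\<close> would lie on a ray of \<open>L\<close> of
      level at least \<open>l\<close>.\<close>
    have "x0 - (n - k + int l) \<le> r - i"
    proof (rule ccontr)
      assume "\<not> ?thesis"
      then have a: "i - r > n - k + int l - x0" by simp
      define j where "j = nat (i - (n - k) - 1)"
      have j: "int j = i - (n - k) - 1" "l \<le> j" using a rect by (auto simp: j_def)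
      have "(r - 1, n - k + int j) \<in> shadow T j"
        using j a rect l' by (intro L_level) auto
      then have "v - (1, 1) \<in> shadow T l"
        using shadow_antimono[OF j(2), of T] j(1) ri by auto
      then show False using l(1) by simp
    qed
    \<comment> \<open>Symmetrically, beyond the \<open>l\<close>-th endpoint \<open>v - (1, 1)\<close> would lie on a ray of \<open>R\<close>.\<close>
    moreover have "r - i \<le> x1 - k + int l - b"
    proof (rule ccontr)
      assume "\<not> ?thesis"
      then have a: "r - i > x1 - k + int l - b" by simp
      define j where "j = nat (r - (x1 - k) - 1)"
      have j: "int j = r - (x1 - k) - 1" "l \<le> j" using a rect by (auto simp: j_def)
      have "(x1 - k + int j, i - 1) \<in> shadow T j"
        using j a rect l' by (intro R_level) auto
      then have "v - (1, 1) \<in> shadow T l"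
        using shadow_antimono[OF j(2), of T] j(1) ri by auto
      then show False using l(1) by simp
    qed
    moreover have "int l \<in> {1..k}" using l(2) l' k(1) by auto
    ultimately show ?thesis using vrim \<pi>(2)[of "int l"] ri by (intro UN_I[of "int l"]) auto
  qed
  then show ?thesis using that[of \<pi>] \<pi>(1) disj unfolding star_tuple_iff by blast
qed

lemma star_tuple_union_of_chains:
  assumes "star_tuple k (x0, n) (x1, b) \<pi>"
  shows "(\<Union>j\<in>{1..k}. set (\<pi> j)) \<subseteq> {x0..x1} \<times> {b..n}"
    and "union_of_chains k (\<Union>j\<in>{1..k}. set (\<pi> j))"
proof -
  show "(\<Union>j\<in>{1..k}. set (\<pi> j)) \<subseteq> {x0..x1} \<times> {b..n}"
  proof clarify
    fix j r i assume j: "j \<in> {1..k}" and v: "(r, i) \<in> set (\<pi> j)"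
    from assms j have "lattice_path (x0, n - k + j) (x1 - k + j, b) (\<pi> j)"
      unfolding star_tuple_iff by blast
    then obtain t where t: "t (n - k + j) = x0" "t (b - 1) = x1 - k + j"
      "\<forall>i\<in>{b..n - k + j}. t i \<le> t (i - 1)" "set (\<pi> j) = staircase t b (n - k + j)"
      by (elim lattice_path_staircase) simp
    show "r \<in> {x0..x1} \<and> i \<in> {b..n}"
      using staircase_columns[OF t(3), of r i] v j t by (auto simp: mem_staircase)
  qed
  show "union_of_chains k (\<Union>j\<in>{1..k}. set (\<pi> j))"
  proof (rule union_of_chainsI[OF subset_refl])
    fix j u v
    assume j: "j \<in> {1..k}" and uv: "u \<in> (\<Union>j\<in>{1..k}. set (\<pi> j)) \<inter> set (\<pi> j)"
      "v \<in> (\<Union>j\<in>{1..k}. set (\<pi> j)) \<inter> set (\<pi> j)" "snd u < snd v"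
    from assms j have "lattice_path (x0, n - k + j) (x1 - k + j, b) (\<pi> j)"
      unfolding star_tuple_iff by blast
    then obtain t where t:
      "\<forall>i\<in>{b..n - k + j}. t i \<le> t (i - 1)" "set (\<pi> j) = staircase t b (n - k + j)"
      by (elim lattice_path_staircase) simp
    show "fst v \<le> fst u"
      using staircase_weakly_monotone[OF t(1), of "fst u" "snd u" "fst v" "snd v"] uv t(2) by auto
  qed
qed

section \<open>The increments of the step functions of a matrix\<close>

lemma finite_positive_ints_le: "finite {r :: int. 1 \<le> r \<and> real_of_int r \<le> y}"
  by (rule finite_subset[of _ "{1..\<lfloor>y\<rfloor>}"]) (auto simp: le_floor_iff)

lemma matrix_fun_tendsto_left:
  "(matrix_fun A i \<longlongrightarrow> (\<Sum>r\<in>{r. 1 \<le> r \<and> real_of_int r < x}. A r i)) (at_left x)"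
proof (rule tendsto_eventually, rule eventually_at_leftI)
  fix t assume t: "t \<in> {real_of_int (\<lceil>x\<rceil> - 1)<..<x}"
  have "{r. 1 \<le> r \<and> real_of_int r \<le> t} = {r. 1 \<le> r \<and> real_of_int r < x}"
  proof -
    \<comment> \<open>There is no integer in the open interval from \<open>\<lceil>x\<rceil> - 1\<close> to \<open>x\<close>.\<close>
    have "real_of_int r \<le> t" if "real_of_int r < x" for r
    proof -
      have "r \<le> \<lceil>x\<rceil> - 1" using that by (simp add: less_ceiling_iff zle_diff1_eq)
      then have "real_of_int r \<le> real_of_int (\<lceil>x\<rceil> - 1)" by (simp only: of_int_le_iff)
      then show ?thesis using t by simp
    qed
    then show ?thesis using t by auto
  qed
  then show "matrix_fun A i t = (\<Sum>r\<in>{r. 1 \<le> r \<and> real_of_int r < x}. A r i)"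
    by (simp add: matrix_fun_def)
qed linarith

lemma matrix_fun_left_limit:
  "left_limit (matrix_fun A i) x = (\<Sum>r\<in>{r. 1 \<le> r \<and> real_of_int r < x}. A r i)"
proof (cases "x \<le> 0")
  case True
  then have "{r :: int. 1 \<le> r \<and> real_of_int r < x} = {}" by auto
  then show ?thesis using True by (simp only: left_limit_def sum.empty if_True)
next
  case False
  then show ?thesis
    using tendsto_Lim[OF _ matrix_fun_tendsto_left] by (simp add: left_limit_def)
qed

lemma matrix_fun_in_cadlag_space:
  assumes "\<And>r i. r \<in> {1..m} \<Longrightarrow> i \<in> {1..n} \<Longrightarrow> 0 \<le> A r i"
  shows "matrix_fun A \<in> cadlag_space m n"
proof -
  have right: "continuous (at_right t) (matrix_fun A i)" for t i
    unfolding continuous_within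
  proof (rule tendsto_eventually, rule eventually_at_rightI)
    fix s assume s: "s \<in> {t<..<real_of_int (\<lfloor>t\<rfloor> + 1)}"
    have "\<lfloor>s\<rfloor> = \<lfloor>t\<rfloor>" using s by (intro floor_unique) (auto intro: order_trans[OF of_int_floor_le])
    then have "{r. 1 \<le> r \<and> real_of_int r \<le> s} = {r. 1 \<le> r \<and> real_of_int r \<le> t}"
      by (simp add: le_floor_iff[symmetric])
    then show "matrix_fun A i s = matrix_fun A i t" by (simp add: matrix_fun_def)
  qed linarith
  have jump: "left_limit (matrix_fun A i) t \<le> matrix_fun A i t"
    if "i \<in> {1..n}" "t \<le> real_of_int m" for i t
    unfolding matrix_fun_left_limit matrix_fun_def
    using assms[OF _ that(1)] that(2)
    by (intro sum_mono2[OF finite_positive_ints_le]) auto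
  have "0 \<le> matrix_fun A i 0" for i by (auto simp: matrix_fun_def intro: sum_nonneg)
  then show ?thesis
    unfolding cadlag_space_def using right jump
    by (auto intro!: exI matrix_fun_tendsto_left)
qed

text \<open>
  Cadlag paths start at column \<open>0\<close>, whereas the step functions only jump from column \<open>1\<close> on.
\<close>

definition lattice_points :: "(real \<times> int) set \<Rightarrow> (int \<times> int) set" where
  "lattice_points U = {(r, i). 1 \<le> r \<and> (real_of_int r, i) \<in> U}"

definition weight :: "(int \<Rightarrow> int \<Rightarrow> real) \<Rightarrow> (int \<times> int) set \<Rightarrow> real" where
  "weight A V = (\<Sum>(r, i)\<in>V. A r i)"

lemma weight_mono:
  assumes "V \<subseteq> W" "W \<subseteq> {1..m} \<times> {1..n}"
    and "\<And>r i. r \<in> {1..m} \<Longrightarrow> i \<in> {1..n} \<Longrightarrow> 0 \<le> A r i"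
  shows "weight A V \<le> weight A W"
proof -
  have "finite W" using assms(2) by (rule finite_subset) simp
  then show ?thesis unfolding weight_def using assms by (intro sum_mono2) auto
qed

text \<open>
  Every component contains one of the sets \<open>K j\<close>, and is determined by any point of it.
\<close>

lemma finite_components_UN_connected:
  fixes K :: "'i \<Rightarrow> 'a::topological_space set"
  assumes "finite J" "\<And>j. j \<in> J \<Longrightarrow> connected (K j)"
  shows "finite (components (\<Union>j\<in>J. K j))"
proof (rule finite_subset)
  let ?X = "\<Union>j\<in>J. K j"
  let ?comp = "\<lambda>j. connected_component_set ?X (SOME x. x \<in> K j)"
  show "components ?X \<subseteq> ?comp ` J"
  proof
    fix C assume "C \<in> components ?X"
    then obtain x where x: "x \<in> ?X" "C = connected_component_set ?X x"
      by (auto simp: components_def)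
    then obtain j where j: "j \<in> J" "x \<in> K j" by blast
    then have "(SOME x. x \<in> K j) \<in> K j" by (intro someI)
    then have "connected_component ?X x (SOME x. x \<in> K j)"
      unfolding connected_component_def using j assms(2) by (intro exI[of _ "K j"]) auto
    then have "C = ?comp j" using x(2) by (simp add: connected_component_eq)
    with j show "C \<in> ?comp ` J" by blast
  qed
  show "finite (?comp ` J)" using assms(1) by simp
qed

text \<open>
  A component is a compact interval \<open>[a, b]\<close>, over which the increment, including the jump at \<open>a\<close>,
  sums the entries at the integers in \<open>[a, b]\<close>. The components partition \<open>X\<close>.
\<close>

lemma sum_components_matrix_fun:
  assumes "compact X" "finite (components X)"
  shows "(\<Sum>C\<in>components X. matrix_fun A i (Sup C) - left_limit (matrix_fun A i) (Inf C)) =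
    (\<Sum>r\<in>{r. 1 \<le> r \<and> real_of_int r \<in> X}. A r i)"
proof -
  let ?I = "\<lambda>C. {r :: int. 1 \<le> r \<and> real_of_int r \<in> C}"
  have comp: "\<exists>a b. a \<le> b \<and> C = {a..b}" if C: "C \<in> components X" for C
  proof -
    have "compact C" using C assms(1)
      by (meson bounded_subset closed_components compact_eq_bounded_closed
          in_components_subset)
    then obtain a b where "C = {a..b}"
      using connected_compact_interval_1[of C] in_components_connected[OF C] by auto
    then show ?thesis using in_components_nonempty[OF C] by force
  qed
  have finI: "finite (?I C)" if "C \<in> components X" for C
    using comp[OF that] by (auto intro: finite_subset[OF _ finite_positive_ints_le])
  have "matrix_fun A i (Sup C) - left_limit (matrix_fun A i) (Inf C) = (\<Sum>r\<in>?I C. A r i)"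
    if "C \<in> components X" for C
  proof -
    obtain a b where ab: "a \<le> b" "C = {a..b}" using comp[OF \<open>C \<in> components X\<close>] by blast
    have "?I C = {r. 1 \<le> r \<and> real_of_int r \<le> b} - {r. 1 \<le> r \<and> real_of_int r < a}"
      using ab by auto
    moreover have "{r :: int. 1 \<le> r \<and> real_of_int r < a} \<subseteq> {r. 1 \<le> r \<and> real_of_int r \<le> b}"
      using ab by auto
    ultimately have "(\<Sum>r\<in>?I C. A r i) = (\<Sum>r\<in>{r. 1 \<le> r \<and> real_of_int r \<le> b}. A r i) -
        (\<Sum>r\<in>{r. 1 \<le> r \<and> real_of_int r < a}. A r i)"
      by (simp only: sum_diff[OF finite_positive_ints_le])
    then show ?thesis using ab by (simp add: matrix_fun_left_limit matrix_fun_def)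
  qed
  then have "(\<Sum>C\<in>components X. matrix_fun A i (Sup C) - left_limit (matrix_fun A i) (Inf C)) =
      (\<Sum>C\<in>components X. \<Sum>r\<in>?I C. A r i)"
    by (intro sum.cong) auto
  also have "\<dots> = (\<Sum>r\<in>(\<Union>C\<in>components X. ?I C). A r i)"
    using assms(2) finI components_nonoverlap[of _ X]
    by (intro sum.UNION_disjoint[symmetric]) blast+
  also have "(\<Union>C\<in>components X. ?I C) = ?I X"
    using Union_components[of X] by blast
  finally show ?thesis .
qed

lemma df_matrix_fun_staircases:
  fixes t :: "'j \<Rightarrow> int \<Rightarrow> real" and b n :: int
  assumes "finite J"
  defines "U \<equiv> (\<Union>j\<in>J. staircase (t j) b n)"
  shows "df (matrix_fun A) U = weight A (lattice_points U)"
proof -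
  let ?slice = "\<lambda>i. {x. (x, i) \<in> U}"
  have fin: "finite (snd ` U)"
    by (rule finite_subset[of _ "{b..n}"]) (auto simp: U_def staircase_def)
  have slice: "?slice i = (\<Union>j\<in>{j \<in> J. b \<le> i \<and> i \<le> n}. {t j i..t j (i - 1)})" for i
    by (auto simp: U_def mem_staircase)
  have compact: "compact (?slice i)" and comps: "finite (components (?slice i))" for i
    unfolding slice using assms(1)
    by (auto intro!: compact_UN finite_components_UN_connected)
  have finI: "finite {r :: int. 1 \<le> r \<and> (real_of_int r, i) \<in> U}" for i
  proof -
    have "bounded (?slice i)" using compact by (rule compact_imp_bounded)
    then obtain B where "\<And>x. x \<in> ?slice i \<Longrightarrow> \<bar>x\<bar> \<le> B"
      unfolding bounded_iff real_norm_def by blast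
    then show ?thesis
      by (intro finite_subset[OF _ finite_positive_ints_le[of B]]) force
  qed
  have "df (matrix_fun A) U = (\<Sum>i\<in>snd ` U. \<Sum>r\<in>{r. 1 \<le> r \<and> (real_of_int r, i) \<in> U}. A r i)"
    unfolding df_def using sum_components_matrix_fun[OF compact comps] by simp
  also have "\<dots> = (\<Sum>(i, r)\<in>(SIGMA i:snd ` U. {r. 1 \<le> r \<and> (real_of_int r, i) \<in> U}). A r i)"
    using fin finI by (intro sum.Sigma) auto
  also have "\<dots> = weight A (lattice_points U)"
    unfolding weight_def lattice_points_def
    by (rule sum.reindex_bij_witness[of _ prod.swap prod.swap]) force+
  finally show ?thesis .
qed

section \<open>Comparing the two last passage problems\<close>

lemma cadlag_pathE:
  assumes "cadlag_path (0, n) (y, b) P"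
  obtains t where "t n = 0" "t (b - 1) = y" "\<forall>i\<in>{b..n}. t i \<le> t (i - 1)" "P = staircase t b n"
  using assms unfolding cadlag_path_def staircase_def by auto

text \<open>
  The tuples of paths that are admitted in \<^term>\<open>cadlag_lpp f k (0, n) (y, b)\<close>.
\<close>

definition cadlag_tuple :: "int \<Rightarrow> int \<Rightarrow> real \<Rightarrow> int \<Rightarrow> (int \<Rightarrow> (real \<times> int) set) \<Rightarrow> bool" where
  "cadlag_tuple k n y b P \<longleftrightarrow> (\<forall>j\<in>{1..k}. cadlag_path (0, n) (y, b) (P j)) \<and>
     (\<forall>i\<in>{1..k}. \<forall>j\<in>{1..k}. i \<noteq> j \<longrightarrow> finite (P i \<inter> P j))"

lemma cadlag_tuple_lattice_points:
  assumes "cadlag_tuple k n y b P"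
  defines "U \<equiv> (\<Union>j\<in>{1..k}. P j)"
  shows "lattice_points U \<subseteq> {1..\<lfloor>y\<rfloor>} \<times> {b..n}"
    and "union_of_chains k (lattice_points U)"
    and "df (matrix_fun A) U = weight A (lattice_points U)"
proof -
  have "\<forall>j\<in>{1..k}. \<exists>t. t n = 0 \<and> t (b - 1) = y \<and> (\<forall>i\<in>{b..n}. t i \<le> t (i - 1)) \<and>
      P j = staircase t b n"
    using assms(1) unfolding cadlag_tuple_def by (meson cadlag_pathE)
  from bchoice[OF this] obtain t where "\<forall>j\<in>{1..k}. t j n = 0 \<and> t j (b - 1) = y \<and>
      (\<forall>i\<in>{b..n}. t j i \<le> t j (i - 1)) \<and> P j = staircase (t j) b n" ..
  then have t: "t j (b - 1) = y" "\<forall>i\<in>{b..n}. t j i \<le> t j (i - 1)" "P j = staircase (t j) b n"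
    if "j \<in> {1..k}" for j
    using that by blast+
  show "lattice_points U \<subseteq> {1..\<lfloor>y\<rfloor>} \<times> {b..n}"
  proof clarify
    fix r i assume "(r, i) \<in> lattice_points U"
    then obtain j where j: "j \<in> {1..k}" "1 \<le> r" "(real_of_int r, i) \<in> P j"
      by (auto simp: lattice_points_def U_def)
    then show "r \<in> {1..\<lfloor>y\<rfloor>} \<and> i \<in> {b..n}"
      using staircase_columns(2)[OF t(2)[OF j(1)], of "real_of_int r" i] t(1,3)[OF j(1)]
      by (auto simp: le_floor_iff mem_staircase)
  qed
  show "union_of_chains k (lattice_points U)"
  proof (rule union_of_chainsI)
    show "lattice_points U \<subseteq> (\<Union>j\<in>{1..k}. lattice_points (P j))"
      by (auto simp: lattice_points_def U_def)
    fix j u v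
    assume j: "j \<in> {1..k}" and uv: "u \<in> lattice_points U \<inter> lattice_points (P j)"
      "v \<in> lattice_points U \<inter> lattice_points (P j)" "snd u < snd v"
    then show "fst v \<le> fst u"
      using staircase_weakly_monotone[OF t(2)[OF j],
          of "real_of_int (fst u)" "snd u" "real_of_int (fst v)" "snd v"] t(3)[OF j]
      by (auto simp: lattice_points_def)
  qed
  have "U = (\<Union>j\<in>{1..k}. staircase (t j) b n)" using t(3) by (simp add: U_def)
  then show "df (matrix_fun A) U = weight A (lattice_points U)"
    using df_matrix_fun_staircases[of "{1..k}" A t b n] by simp
qed

text \<open>
  The columns \<open>1 - k..\<lfloor>y\<rfloor> + k\<close> leave enough room on both sides to cover \<open>S\<close> by disjoint lattice
  paths that begin to the left of column \<open>1\<close> and end to the right of \<open>y\<close>. Clamping columns to \<open>[0, y]\<close>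
  turns them into cadlag paths: everything to the left collapses to the vertical line at \<open>0\<close> and
  everything to the right to the vertical line at \<open>y\<close>. Disjoint integer intervals on a line are
  ordered, and monotone clamping leaves them at most one common point, so the intersections are
  finite.
\<close>

lemma union_of_chains_covered_by_cadlag_tuple:
  assumes "0 \<le> y" "1 \<le> k" "k \<le> n - b + 1"
    and S: "S \<subseteq> {1..\<lfloor>y\<rfloor>} \<times> {b..n}" "union_of_chains k S"
  obtains P where "cadlag_tuple k n y b P" "S \<subseteq> lattice_points (\<Union>j\<in>{1..k}. P j)"
proof -
  let ?x = "\<lfloor>y\<rfloor>"
  have x: "0 \<le> ?x" using assms(1) by simp
  have "k \<le> ?x + k - (1 - k) + 1" "S \<subseteq> {1 - k..?x + k} \<times> {b..n}"
    using S(1) assms(2) x by auto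
  then obtain \<pi> where \<pi>: "star_tuple k (1 - k, n) (?x + k, b) \<pi>"
      "S \<subseteq> (\<Union>j\<in>{1..k}. set (\<pi> j))"
    using union_of_chains_covered_by_star_tuple[OF assms(2) _ assms(3) _ S(2)] by metis
  have "\<exists>t. t (n - k + j) = 1 - k \<and> t (b - 1) = ?x + j \<and>
      (\<forall>i\<in>{b..n - k + j}. t i \<le> t (i - 1)) \<and> set (\<pi> j) = staircase t b (n - k + j)"
    if "j \<in> {1..k}" for j
  proof -
    have "lattice_path (1 - k, n - k + j) (?x + j, b) (\<pi> j)" using \<pi>(1) that by (simp add: star_tuple_iff)
    then show ?thesis by (rule lattice_path_staircase) auto
  qed
  then have "\<forall>j\<in>{1..k}. \<exists>t. t (n - k + j) = 1 - k \<and> t (b - 1) = ?x + j \<and>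
      (\<forall>i\<in>{b..n - k + j}. t i \<le> t (i - 1)) \<and> set (\<pi> j) = staircase t b (n - k + j)"
    by blast
  from bchoice[OF this] obtain t where "\<forall>j\<in>{1..k}. t j (n - k + j) = 1 - k \<and>
      t j (b - 1) = ?x + j \<and> (\<forall>i\<in>{b..n - k + j}. t j i \<le> t j (i - 1)) \<and>
      set (\<pi> j) = staircase (t j) b (n - k + j)" ..
  then have t: "t j (n - k + j) = 1 - k" "t j (b - 1) = ?x + j"
      "\<And>i. b \<le> i \<Longrightarrow> i \<le> n - k + j \<Longrightarrow> t j i \<le> t j (i - 1)"
      "set (\<pi> j) = staircase (t j) b (n - k + j)" if "j \<in> {1..k}" for j
    using that by auto
  define clamp where "clamp z = max 0 (min y (real_of_int z))" for z
  have clamp_mono: "z \<le> z' \<Longrightarrow> clamp z \<le> clamp z'" for z z'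
    by (auto simp: clamp_def)
  have clamp_start: "clamp (1 - k) = 0" using assms(2) by (simp add: clamp_def)
  have clamp_end: "clamp (?x + j) = y" if "j \<in> {1..k}" for j
  proof -
    have "1 \<le> real_of_int j" using that by simp
    then have "y \<le> real_of_int (?x + j)" by linarith
    then have "min y (real_of_int (?x + j)) = y" by (rule min_absorb1)
    then show ?thesis using assms(1) by (simp only: clamp_def max_absorb2)
  qed
  \<comment> \<open>Path \<open>j\<close> starts on line \<open>n - k + j\<close>; from \<open>(0, n)\<close> the cadlag path first climbs there along the
    vertical line at \<open>0\<close>.\<close>
  define s where "s j i = (if n - k + j < i then 0 else clamp (t j i))" for j i
  define P where "P j = staircase (s j) b n" for j
  have "cadlag_path (0, n) (y, b) (P j)" if j: "j \<in> {1..k}" for j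
  proof -
    have "s j n = 0" using t(1)[OF j] clamp_start j by (cases "j = k") (auto simp: s_def)
    moreover have "s j (b - 1) = y" using t(2)[OF j] clamp_end[OF j] assms(3) j by (simp add: s_def)
    moreover have "s j i \<le> s j (i - 1)" if "i \<in> {b..n}" for i
    proof (cases "n - k + j < i")
      case True
      then show ?thesis by (simp add: s_def clamp_def)
    next
      case False
      then show ?thesis using that t(3)[OF j] by (simp add: s_def clamp_mono)
    qed
    ultimately show ?thesis
      unfolding cadlag_path_def P_def staircase_def by (intro exI[of _ "s j"]) auto
  qed
  moreover have "finite (P i \<inter> P j)" if ij: "i \<in> {1..k}" "j \<in> {1..k}" "i \<noteq> j" for i j
  proof (rule finite_subset)
    show "P i \<inter> P j \<subseteq> (\<Union>l\<in>{b..n}. {0, s i l, s j l} \<times> {l})"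
    proof clarify
      fix z l assume z: "(z, l) \<in> P i" "(z, l) \<in> P j"
      have l: "b \<le> l" "l \<le> n" "s i l \<le> z" "z \<le> s i (l - 1)" "s j l \<le> z" "z \<le> s j (l - 1)"
        using z by (auto simp: P_def mem_staircase)
      have start: "z = 0" if "j' \<in> {1..k}" "n - k + j' < l" "s j' l \<le> z" "z \<le> s j' (l - 1)" for j'
        using that t(1)[OF that(1)] clamp_start
        by (cases "l - 1 = n - k + j'") (auto simp: s_def)
      show "(z, l) \<in> (\<Union>l\<in>{b..n}. {0, s i l, s j l} \<times> {l})"
      proof (cases "n - k + i < l \<or> n - k + j < l")
        case True
        then have "z = 0" using start[of i] start[of j] ij l by blast
        then show ?thesis using l by (intro UN_I[of l]) auto
      next
        case False
        then have row: "(t i l, l) \<in> set (\<pi> i)" "(t j l, l) \<in> set (\<pi> j)"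
          "\<And>w. w \<in> {t i l..t i (l - 1)} \<Longrightarrow> (w, l) \<in> set (\<pi> i)"
          "\<And>w. w \<in> {t j l..t j (l - 1)} \<Longrightarrow> (w, l) \<in> set (\<pi> j)"
          using t(3,4)[OF ij(1)] t(3,4)[OF ij(2)] l by (auto simp: mem_staircase)
        have "set (\<pi> i) \<inter> set (\<pi> j) = {}"
          using \<pi>(1) ij by (auto simp: star_tuple_def disjoint_family_on_def)
        then have "t i (l - 1) < t j l \<or> t j (l - 1) < t i l"
          using row(1,2) row(3)[of "t j l"] row(4)[of "t i l"] by force
        then have "s i (l - 1) \<le> s j l \<or> s j (l - 1) \<le> s i l"
          using False by (auto simp: s_def intro: clamp_mono)
        then have "z = s j l \<or> z = s i l" using l by auto
        then show ?thesis using l by (intro UN_I[of l]) auto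
      qed
    qed
  qed simp
  moreover have "S \<subseteq> lattice_points (\<Union>j\<in>{1..k}. P j)"
  proof clarify
    fix r i assume ri: "(r, i) \<in> S"
    with \<pi>(2) obtain j where j: "j \<in> {1..k}" "(r, i) \<in> set (\<pi> j)" by blast
    have ri': "1 \<le> r" "r \<le> ?x" "b \<le> i" "i \<le> n" using ri S(1) by auto
    have st: "i \<le> n - k + j" "t j i \<le> r" "r \<le> t j (i - 1)"
      using j t(4)[OF j(1)] by (auto simp: mem_staircase)
    have "clamp r = real_of_int r" using ri' by (simp add: clamp_def le_floor_iff)
    then have "(real_of_int r, i) \<in> P j"
      using clamp_mono[OF st(2)] clamp_mono[OF st(3)] st(1) ri'
      by (simp add: P_def mem_staircase s_def)
    then show "(r, i) \<in> lattice_points (\<Union>j\<in>{1..k}. P j)"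
      using j ri' by (auto simp: lattice_points_def)
  qed
  ultimately show ?thesis using that[of P] by (simp add: cadlag_tuple_def)
qed

lemma lattice_lpp_star_weight:
  "lattice_lpp_star A k p q = Max {weight A (\<Union>j\<in>{1..k}. set (\<pi> j)) | \<pi>. star_tuple k p q \<pi>}"
proof -
  have "(\<Sum>i\<in>{1..k}. \<Sum>(r, j)\<in>set (\<pi> i). A r j) = weight A (\<Union>j\<in>{1..k}. set (\<pi> j))"
    if "disjoint_family_on (\<lambda>i. set (\<pi> i)) {1..k}" for \<pi> :: "int \<Rightarrow> (int \<times> int) list"
    unfolding weight_def using that
    by (intro sum.UNION_disjoint[symmetric]) (auto simp: disjoint_family_on_def)
  then show ?thesis
    unfolding lattice_lpp_star_def lattice_lpp_def star_tuple_def
    by (intro arg_cong[where f = Max] Collect_cong iff_exI) auto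
qed

lemma finite_star_weights:
  "finite {weight A (\<Union>j\<in>{1..k}. set (\<pi> j)) | \<pi>. star_tuple k (x0, n) (x1, b) \<pi>}"
proof (rule finite_subset)
  show "{weight A (\<Union>j\<in>{1..k}. set (\<pi> j)) | \<pi>. star_tuple k (x0, n) (x1, b) \<pi>} \<subseteq>
      weight A ` Pow ({x0..x1} \<times> {b..n})"
    using star_tuple_union_of_chains(1) by blast
qed simp

lemma cadlag_lpp_matrix_fun:
  assumes "1 \<le> k"
  shows "cadlag_lpp (matrix_fun A) k (0, n) (y, b) =
    Sup {weight A (lattice_points (\<Union>j\<in>{1..k}. P j)) | P. cadlag_tuple k n y b P}"
proof -
  have "df (matrix_fun A) (\<Union>j\<in>{1..k}. P j) = weight A (lattice_points (\<Union>j\<in>{1..k}. P j))"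
    if "cadlag_tuple k n y b P" for P
    using that by (rule cadlag_tuple_lattice_points(3))
  then have "{df (matrix_fun A) (\<Union>j\<in>{1..k}. P j) | P. cadlag_tuple k n y b P} =
      {weight A (lattice_points (\<Union>j\<in>{1..k}. P j)) | P. cadlag_tuple k n y b P}"
    by (intro Collect_cong iff_exI) auto
  then show ?thesis using assms by (simp add: cadlag_lpp_def cadlag_tuple_def)
qed

text \<open>
  Each set of lattice points met by \<open>k\<close> cadlag paths is covered by \<open>min k \<lfloor>y\<rfloor>\<close> disjoint lattice
  paths, and conversely; nonnegativity of the entries turns coverings into inequalities. The converse
  covering of an optimal tuple of lattice paths shows that the supremum is attained.
\<close>

lemma cadlag_lpp_eq_lattice_lpp_star:
  assumes nonneg: "\<And>r i. r \<in> {1..m} \<Longrightarrow> i \<in> {1..n} \<Longrightarrow> 0 \<le> A r i"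
    and k: "0 \<le> k" "k \<le> n - b + 1" and "1 \<le> b" and y: "1 \<le> y" "y \<le> real_of_int m"
  shows "cadlag_lpp (matrix_fun A) k (0, n) (y, b) =
    lattice_lpp_star A (min k \<lfloor>y\<rfloor>) (1, n) (\<lfloor>y\<rfloor>, b)"
proof (cases "k = 0")
  case True
  then show ?thesis using y by (simp add: cadlag_lpp_def lattice_lpp_star_0)
next
  case False
  define x where "x = \<lfloor>y\<rfloor>"
  define k' where "k' = min k x"
  have x: "1 \<le> x" "x \<le> m" using y by (auto simp: x_def le_floor_iff floor_le_iff)
  have k': "1 \<le> k'" "k' \<le> k" "k' \<le> x" using False k x by (auto simp: k'_def)
  have rect: "{1..x} \<times> {b..n} \<subseteq> {1..m} \<times> {1..n}" using x \<open>1 \<le> b\<close> by auto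
  have k'_rect: "k' \<le> x - 1 + 1" "k' \<le> n - b + 1" using k' k by auto
  let ?X = "{weight A (lattice_points (\<Union>j\<in>{1..k}. P j)) | P. cadlag_tuple k n y b P}"
  let ?Y = "{weight A (\<Union>j\<in>{1..k'}. set (\<pi> j)) | \<pi>. star_tuple k' (1, n) (x, b) \<pi>}"
  have upper: "w \<le> Max ?Y" if "w \<in> ?X" for w
  proof -
    from that obtain P where P: "cadlag_tuple k n y b P"
      "w = weight A (lattice_points (\<Union>j\<in>{1..k}. P j))"
      by blast
    let ?S = "lattice_points (\<Union>j\<in>{1..k}. P j)"
    have S: "?S \<subseteq> {1..x} \<times> {b..n}" "union_of_chains k ?S"
      using cadlag_tuple_lattice_points(1,2)[OF P(1)] by (simp_all only: x_def)
    \<comment> \<open>The \<open>x\<close> columns of the rectangle are chains, too.\<close>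
    have chains: "union_of_chains k' ?S"
      using S(2) union_of_chains_columns[OF S(1)] by (simp add: k'_def min_def)
    obtain \<pi> where \<pi>: "star_tuple k' (1, n) (x, b) \<pi>" "?S \<subseteq> (\<Union>j\<in>{1..k'}. set (\<pi> j))"
      by (rule union_of_chains_covered_by_star_tuple[OF k'(1) k'_rect S(1) chains])
    have "w \<le> weight A (\<Union>j\<in>{1..k'}. set (\<pi> j))"
      unfolding P(2) using star_tuple_union_of_chains(1)[OF \<pi>(1)] rect
      by (intro weight_mono[OF \<pi>(2) _ nonneg]) auto
    also have "\<dots> \<le> Max ?Y"
      using \<pi>(1) by (intro Max_ge[OF finite_star_weights]) blast
    finally show ?thesis .
  qed
  have "?Y \<noteq> {}"
  proof -
    have "union_of_chains k' {}" by (simp add: union_of_chains_def)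
    from union_of_chains_covered_by_star_tuple[OF k'(1) k'_rect empty_subsetI this]
    obtain \<pi> where "star_tuple k' (1, n) (x, b) \<pi>" .
    then show ?thesis by blast
  qed
  then have "Max ?Y \<in> ?Y" by (rule Max_in[OF finite_star_weights])
  then obtain \<pi> where \<pi>: "star_tuple k' (1, n) (x, b) \<pi>" "Max ?Y = weight A (\<Union>j\<in>{1..k'}. set (\<pi> j))"
    by blast
  let ?S = "\<Union>j\<in>{1..k'}. set (\<pi> j)"
  have S: "?S \<subseteq> {1..x} \<times> {b..n}" "union_of_chains k' ?S"
    using star_tuple_union_of_chains[OF \<pi>(1)] .
  have chains: "union_of_chains k ?S"
    using S(2) k'(2) by (rule union_of_chains_mono)
  have y0: "0 \<le> y" and k1: "1 \<le> k" using y(1) k(1) False by auto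
  from union_of_chains_covered_by_cadlag_tuple[OF y0 k1 k(2) S(1)[unfolded x_def] chains]
  obtain P where P: "cadlag_tuple k n y b P" "?S \<subseteq> lattice_points (\<Union>j\<in>{1..k}. P j)" .
  have "lattice_points (\<Union>j\<in>{1..k}. P j) \<subseteq> {1..m} \<times> {1..n}"
    using subset_trans[OF cadlag_tuple_lattice_points(1)[OF P(1), folded x_def] rect] .
  then have lower: "Max ?Y \<le> weight A (lattice_points (\<Union>j\<in>{1..k}. P j))"
    unfolding \<pi>(2) by (rule weight_mono[OF P(2) _ nonneg])
  have X: "weight A (lattice_points (\<Union>j\<in>{1..k}. P j)) \<in> ?X" using P(1) by blast
  have "Max ?Y = weight A (lattice_points (\<Union>j\<in>{1..k}. P j))"
    using lower upper[OF X] by (rule antisym)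
  with X have "Max ?Y \<in> ?X" by (simp only:)
  then have "Sup ?X = Max ?Y" using upper by (rule cSup_eq_maximum)
  then show ?thesis
    using False k by (simp add: cadlag_lpp_matrix_fun lattice_lpp_star_weight k'_def x_def)
qed

text \<open>
  Before time \<open>1\<close> no lattice point has been reached. The existence of an admissible tuple still matters,
  since otherwise the supremum would be over the empty set.
\<close>

lemma cadlag_lpp_eq_0:
  assumes "0 \<le> k" "k \<le> n - b + 1" "0 \<le> y" "y < 1"
  shows "cadlag_lpp (matrix_fun A) k (0, n) (y, b) = 0"
proof (cases "k = 0")
  case True
  then show ?thesis by (simp add: cadlag_lpp_def)
next
  case False
  have y: "\<lfloor>y\<rfloor> = 0" using assms by (simp add: floor_eq_iff)
  have "lattice_points (\<Union>j\<in>{1..k}. P j) = {}" if "cadlag_tuple k n y b P" for P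
    using cadlag_tuple_lattice_points(1)[OF that] y by simp
  then have "weight A (lattice_points (\<Union>j\<in>{1..k}. P j)) = 0" if "cadlag_tuple k n y b P" for P
    using that by (simp add: weight_def)
  moreover have "\<exists>P. cadlag_tuple k n y b P"
  proof -
    have k: "1 \<le> k" "union_of_chains k {}"
      using assms(1) False by (auto simp: union_of_chains_def)
    from union_of_chains_covered_by_cadlag_tuple[OF assms(3) k(1) assms(2) empty_subsetI k(2)]
    show ?thesis by metis
  qed
  ultimately have "{weight A (lattice_points (\<Union>j\<in>{1..k}. P j)) | P. cadlag_tuple k n y b P} = {0}"
    by (intro set_eqI iffI; elim CollectE exE conjE singletonE; force)
  then show ?thesis using False assms(1) by (simp add: cadlag_lpp_matrix_fun)
qed

theorem corollary8p4:
  fixes m n :: int and A :: "int \<Rightarrow> int \<Rightarrow> real"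
  assumes "1 \<le> m" and "1 \<le> n"
    and "\<And>r i. r \<in> {1..m} \<Longrightarrow> i \<in> {1..n} \<Longrightarrow> A r i \<in> \<nat>"
  shows "matrix_fun A \<in> cadlag_space m n \<and>
         (WA m n A, GA m n A) = (Wm m n (matrix_fun A), Gm m n (matrix_fun A)) \<and>
         (Wm m n (matrix_fun A), Gm m n (matrix_fun A)) = RSKm m n (matrix_fun A)"
proof -
  have nonneg: "0 \<le> A r i" if "r \<in> {1..m}" "i \<in> {1..n}" for r i
    using assms(3)[OF that] by (auto simp: Nats_def)
  have "WA m n A = Wm m n (matrix_fun A)"
    unfolding WA_def Wm_def
  proof (intro restrict_ext)
    fix j t assume j: "j \<in> {1..n}" and t: "t \<in> {0..real_of_int m}"
    show "(if t < 1 then 0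
        else lattice_lpp_star A (min j \<lfloor>t\<rfloor>) (1, n) (\<lfloor>t\<rfloor>, 1)
          - lattice_lpp_star A (min (j - 1) \<lfloor>t\<rfloor>) (1, n) (\<lfloor>t\<rfloor>, 1)) =
      cadlag_lpp (matrix_fun A) j (0, n) (t, 1) - cadlag_lpp (matrix_fun A) (j - 1) (0, n) (t, 1)"
      using j t cadlag_lpp_eq_0[of j n 1 t A] cadlag_lpp_eq_0[of "j - 1" n 1 t A]
        cadlag_lpp_eq_lattice_lpp_star[of m n A j 1 t, OF nonneg]
        cadlag_lpp_eq_lattice_lpp_star[of m n A "j - 1" 1 t, OF nonneg]
      by auto
  qed
  moreover have "GA m n A = Gm m n (matrix_fun A)"
    unfolding GA_def Gm_def
  proof (intro restrict_ext)
    fix j i assume "j \<in> {1..n}" "i \<in> {j..n}"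
    then show "lattice_lpp_star A (min j m) (1, n) (m, n - i + 1)
        - lattice_lpp_star A (min (j - 1) m) (1, n) (m, n - i + 1) =
      cadlag_lpp (matrix_fun A) j (0, n) (real_of_int m, n - i + 1)
        - cadlag_lpp (matrix_fun A) (j - 1) (0, n) (real_of_int m, n - i + 1)"
      using \<open>1 \<le> m\<close>
        cadlag_lpp_eq_lattice_lpp_star[of m n A j "n - i + 1" "real_of_int m", OF nonneg]
        cadlag_lpp_eq_lattice_lpp_star[of m n A "j - 1" "n - i + 1" "real_of_int m", OF nonneg]
      by simp
  qed
  ultimately show ?thesis
    using matrix_fun_in_cadlag_space[OF nonneg] by (simp add: RSKm_def)
qed

end
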